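(* Let $\alpha\in\{1,-1\}$. Then the totally real algebraic numbers $c$ such that $\alpha$ is $f_c$-preperiodic are exactly $-2-\sqrt{2},\ -3,\ -2,\ -1,\ -2+\sqrt{2},\ 0$.
   Context: For $c\in\mathbb{C}$ let $f_c(x)=x^2+c$, and let $f_c^n$ denote the $n$-fold composition of $f_c$ with itself ($f_c^0$ is the identity). A point $\alpha$ is $f_c$-preperiodic if $f_c^n(\alpha)=f_c^m(\alpha)$ for some integers $0\le m<n$. An algebraic number $c\in\overline{\mathbb{Q}}$ is totally real if all complex roots of its minimal polynomial over $\mathbb{Q}$ are real. *)

theory Defs
  imports Complex_Main "HOL-Computational_Algebra.Computational_Algebra"
begin

definition preperiodic :: "('a \<Rightarrow> 'a) \<Rightarrow> 'a \<Rightarrow> bool" where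
  "preperiodic f x \<longleftrightarrow> (\<exists>m n. m < n \<and> (f ^^ n) x = (f ^^ m) x)"

definition quad :: "complex \<Rightarrow> complex \<Rightarrow> complex" where
  "quad c x = x ^ 2 + c"

definition is_rat_min_poly :: "complex \<Rightarrow> rat poly \<Rightarrow> bool" where
  "is_rat_min_poly c p \<longleftrightarrow>
     lead_coeff p = 1 \<and> poly (map_poly of_rat p) c = 0 \<and>
     (\<forall>q. q \<noteq> 0 \<longrightarrow> poly (map_poly of_rat q) c = 0 \<longrightarrow> degree p \<le> degree q)"

text \<open>The minimal polynomial over the rationals; only meaningful for algebraic \<open>c\<close>,
  in which case it exists and is unique by \<open>ex1_rat_min_poly\<close> below.\<close>

definition rat_min_poly :: "complex \<Rightarrow> rat poly" where
  "rat_min_poly c = (THE p. is_rat_min_poly c p)"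

definition totally_real :: "complex \<Rightarrow> bool" where
  "totally_real c \<longleftrightarrow> algebraic c \<and>
     (\<forall>z::complex. poly (map_poly of_rat (rat_min_poly c)) z = 0 \<longrightarrow> z \<in> \<real>)"

lemma poly_of_rat_add:
  "poly (map_poly of_rat (p + q)) (c::complex) =
     poly (map_poly of_rat p) c + poly (map_poly of_rat q) c"
proof -
  have "map_poly of_rat (p + q) = (map_poly of_rat p + map_poly of_rat q :: complex poly)"
    by (rule poly_eqI) (simp add: coeff_map_poly of_rat_add)
  thus ?thesis by simp
qed

lemma poly_of_rat_smult:
  "poly (map_poly of_rat (smult a p)) (c::complex) = of_rat a * poly (map_poly of_rat p) c"
proof -
  have "map_poly of_rat (smult a p) = (smult (of_rat a) (map_poly of_rat p) :: complex poly)"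
    by (rule poly_eqI) (simp add: coeff_map_poly of_rat_mult)
  thus ?thesis by simp
qed

lemma ex1_rat_min_poly:
  assumes "algebraic c"
  shows "\<exists>!p. is_rat_min_poly c p"
proof -
  define P where "P q \<longleftrightarrow> q \<noteq> 0 \<and> poly (map_poly of_rat q) c = 0" for q :: "rat poly"
  obtain p :: "complex poly"
    where p: "\<And>i. coeff p i \<in> \<rat>" "p \<noteq> 0" "poly p c = 0"
    using assms by (auto simp: algebraic_altdef)
  obtain q :: "rat poly" where q: "p = map_poly of_rat q"
    using p(1) ratpolyE by blast
  have "P q" using p q by (auto simp: P_def)
  define m where "m = arg_min degree P"
  have m: "P m" and min: "\<And>q. P q \<Longrightarrow> degree m \<le> degree q"
    unfolding m_def using \<open>P q\<close> by (auto intro: arg_min_natI arg_min_nat_le)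
  define n where "n = smult (inverse (lead_coeff m)) m"
  have "is_rat_min_poly c n"
    using m min by (auto simp: n_def P_def is_rat_min_poly_def poly_of_rat_smult)
  moreover have "p1 = p2" if "is_rat_min_poly c p1" "is_rat_min_poly c p2" for p1 p2
  proof (rule ccontr)
    assume "p1 \<noteq> p2"
    define d where "d = p1 + smult (-1) p2"
    have nz: "d \<noteq> 0" using \<open>p1 \<noteq> p2\<close> by (simp add: d_def)
    have deg: "degree p1 = degree p2"
      using that unfolding is_rat_min_poly_def
      by (metis le_antisym leading_coeff_0_iff zero_neq_one)
    have "poly (map_poly of_rat d) c = 0"
      using that unfolding d_def is_rat_min_poly_def
      by (simp only: poly_of_rat_add poly_of_rat_smult) simp
    hence "degree p1 \<le> degree d" using that(1) nz by (auto simp: is_rat_min_poly_def)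
    moreover have "degree d \<le> degree p1"
      unfolding d_def using deg by (intro degree_add_le) auto
    moreover have "coeff d (degree p1) = 0"
      using that deg by (simp add: d_def is_rat_min_poly_def)
    ultimately show False using nz by (metis le_antisym leading_coeff_0_iff)
  qed
  ultimately show ?thesis by blast
qed

end

(* If alpha = 1 or -1 is preperiodic, then so is 1, and c is a root of the difference of two orbit
   polynomials f_c^n(1) - f_c^m(1), which is monic with integer coefficients; hence the minimal
   polynomial p of c has integer coefficients, and 1 is preperiodic for every conjugate of c. For
   real x, a point z of an orbit with |z| < f_x(z) is followed by a strictly increasing orbit.
   Therefore all conjugates lie in a union of three intervals inside [-2 - sqrt 2, 0]: the two gaps
   around parameters for which the orbit of 1 hits 0 and then escapes are excluded. On these intervals
     |x|^13 |x+1|^7 |x+2|^16 |x+3|^10 |x^2+4x+2|^11 < 1.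
   The product of this expression over the conjugates is a product of powers of |p(0)|, |p(-1)|,
   |p(-2)|, |p(-3)| and |p(-2 + sqrt 2) p(-2 - sqrt 2)|, hence a nonnegative integer less than 1.
   So it vanishes, and c is a root of x, x+1, x+2, x+3 or x^2+4x+2. *)

theory Submission
  imports Defs
begin

section \<open>An auxiliary function that is small on the real parameters\<close>

text \<open>With u = \<open>y i / t i\<close>, the bound u \<le> exp (u - 1) is raised to the power
  \<open>a i\<close> and multiplied over \<open>I\<close>; by \<open>le\<close> the total exponent
  is at most 0. Since \<open>t\<close> can be chosen freely, bounding a product reduces to one
  linear inequality in \<open>y\<close>.\<close>

lemma weighted_am_gm:
  fixes y t :: "'i \<Rightarrow> real" and a :: "'i \<Rightarrow> nat"
  assumes "finite I" "\<And>i. i \<in> I \<Longrightarrow> 0 \<le> y i" "\<And>i. i \<in> I \<Longrightarrow> 0 < t i"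
    and le: "(\<Sum>i\<in>I. a i * (y i / t i)) \<le> (\<Sum>i\<in>I. real (a i))"
  shows "(\<Prod>i\<in>I. y i ^ a i) \<le> (\<Prod>i\<in>I. t i ^ a i)"
proof -
  have step: "y i ^ a i \<le> t i ^ a i * exp (a i * (y i / t i - 1))" if i: "i \<in> I" for i
  proof -
    have "(y i / t i) ^ a i \<le> exp (y i / t i - 1) ^ a i"
      using exp_ge_add_one_self[of "y i / t i - 1"] assms(2,3)[OF i] by (intro power_mono) auto
    hence "t i ^ a i * (y i / t i) ^ a i \<le> t i ^ a i * exp (a i * (y i / t i - 1))"
      using assms(3)[OF i] by (simp add: exp_of_nat_mult)
    thus ?thesis
      using assms(3)[OF i] by (simp add: power_divide)
  qed
  have "(\<Prod>i\<in>I. y i ^ a i) \<le> (\<Prod>i\<in>I. t i ^ a i * exp (a i * (y i / t i - 1)))"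
    using assms(2) step by (intro prod_mono) auto
  also have "\<dots> = (\<Prod>i\<in>I. t i ^ a i) * exp (\<Sum>i\<in>I. a i * (y i / t i - 1))"
    by (simp add: prod.distrib exp_sum assms(1))
  also have "\<dots> \<le> (\<Prod>i\<in>I. t i ^ a i) * 1"
  proof (intro mult_left_mono)
    show "exp (\<Sum>i\<in>I. a i * (y i / t i - 1)) \<le> 1"
      using le by (simp add: right_diff_distrib sum_subtractf)
    show "0 \<le> (\<Prod>i\<in>I. t i ^ a i)"
      using assms(3) by (intro prod_nonneg) (auto intro: less_imp_le)
  qed
  finally show ?thesis by simp
qed

text \<open>The exponents come from a numerical linear program: they make the maximum over the set of
  real parameters that matter negative on the logarithmic scale.\<close>

definition aux_weight :: "real \<Rightarrow> real" where
  "aux_weight x = \<bar>x\<bar> ^ 13 * \<bar>x + 1\<bar> ^ 7 * \<bar>x + 2\<bar> ^ 16 * \<bar>x + 3\<bar> ^ 10 *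
     (\<bar>x + 2 - sqrt 2\<bar> * \<bar>x + 2 + sqrt 2\<bar>) ^ 11"

text \<open>Here 68 is the sum of the six exponents. Once the signs inside the absolute values are
  known, the seventh hypothesis is linear in \<open>x\<close>; the last one is purely
  numerical.\<close>

lemma aux_weight_less_1I:
  assumes "0 < t0" "0 < t1" "0 < t2" "0 < t3" "0 < t4" "0 < t5"
    and "13 * (\<bar>x\<bar> / t0) + 7 * (\<bar>x + 1\<bar> / t1) + 16 * (\<bar>x + 2\<bar> / t2) + 10 * (\<bar>x + 3\<bar> / t3)
           + 11 * (\<bar>x + 2 - sqrt 2\<bar> / t4) + 11 * (\<bar>x + 2 + sqrt 2\<bar> / t5) \<le> 68"
    and "t0 ^ 13 * t1 ^ 7 * t2 ^ 16 * t3 ^ 10 * t4 ^ 11 * t5 ^ 11 < 1"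
  shows "aux_weight x < 1"
proof -
  define a :: "nat list" where "a = [13, 7, 16, 10, 11, 11]"
  define y where "y = [\<bar>x\<bar>, \<bar>x + 1\<bar>, \<bar>x + 2\<bar>, \<bar>x + 3\<bar>, \<bar>x + 2 - sqrt 2\<bar>, \<bar>x + 2 + sqrt 2\<bar>]"
  define t where "t = [t0, t1, t2, t3, t4, t5]"
  have 6: "{..<6} = {0, 1, 2, 3, 4, 5 :: nat}" by auto
  have "(\<Prod>i<6. (y ! i) ^ (a ! i)) \<le> (\<Prod>i<6. (t ! i) ^ (a ! i))"
    using assms(1-7)
    by (intro weighted_am_gm) (auto simp: 6 a_def y_def t_def)
  thus ?thesis
    using assms(8) by (simp add: 6 a_def y_def t_def aux_weight_def power_mult_distrib mult.assoc)
qed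

lemma sqrt_2_bounds: "1414213 / 1000000 < sqrt (2::real)" "sqrt (2::real) < 1414214 / 1000000"
  by (rule real_less_rsqrt, simp add: power2_eq_square)
     (rule real_less_lsqrt, simp_all add: power2_eq_square)

text \<open>Between consecutive zeros \<open>ln aux_weight\<close> is concave, so one application of AM-GM per
  interval suffices; the rational parameters approximate the distances to the zeros from a point
  where \<open>aux_weight\<close> is close to its maximum on the interval.\<close>

lemma aux_weight_less_1:
  assumes "-2 - sqrt 2 \<le> x \<and> x \<le> -332/100 \<or> -316/100 \<le> x \<and> x \<le> -293/100 \<or> -237/100 \<le> x \<and> x \<le> 0"
  shows "aux_weight x < 1"
proof -
  note s = sqrt_2_bounds
  consider "-2 - sqrt 2 \<le> x" "x \<le> -332/100" | "-316/100 \<le> x" "x \<le> -3" | "-3 \<le> x" "x \<le> -293/100"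
    | "-237/100 \<le> x" "x \<le> -2" | "-2 \<le> x" "x \<le> -1" | "-1 \<le> x" "x \<le> -2 + sqrt 2"
    | "-2 + sqrt 2 \<le> x" "x \<le> 0"
    using assms by linarith
  thus ?thesis
  proof cases
    case 1
    show ?thesis
      by (rule aux_weight_less_1I[of "333/100" "233/100" "133/100" "33/100" "137/50" "9/100"])
         (use 1 s in \<open>simp_all add: power_divide field_simps\<close>)
  next
    case 2
    show ?thesis
      by (rule aux_weight_less_1I[of "79/25" "54/25" "29/25" "4/25" "257/100" "13/50"])
         (use 2 s in \<open>simp_all add: power_divide field_simps\<close>)
  next
    case 3
    show ?thesis
      by (rule aux_weight_less_1I[of "147/50" "97/50" "93/100" "7/100" "47/20" "12/25"])
         (use 3 s in \<open>simp_all add: power_divide field_simps\<close>)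
  next
    case 4
    show ?thesis
      by (rule aux_weight_less_1I[of "237/100" "137/100" "37/100" "63/100" "89/50" "21/20"])
         (use 4 s in \<open>simp_all add: power_divide field_simps\<close>)
  next
    case 5
    show ?thesis
      by (rule aux_weight_less_1I[of "709/500" "52/125" "73/125" "198/125" "104/125" 2])
         (use 5 s in \<open>simp_all add: power_divide field_simps\<close>)
  next
    case 6
    show ?thesis
      by (rule aux_weight_less_1I[of "41/50" "9/50" "59/50" "109/50" "6/25" "259/100"])
         (use 6 s in \<open>simp_all add: power_divide field_simps\<close>)
  next
    case 7
    show ?thesis
      by (rule aux_weight_less_1I[of "23/100" "31/40" "89/50" "139/50" "71/200" "16/5"])
         (use 7 s in \<open>simp_all add: power_divide field_simps\<close>)
  qed
qed

section \<open>Real parameters\<close>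

text \<open>If \<open>\<bar>z k\<bar> < z (Suc k)\<close>, then squaring and adding \<open>x\<close>
  gives \<open>z (Suc k) < z (Suc (Suc k))\<close> with \<open>z (Suc k)\<close> positive. The
  inequality therefore propagates, and the orbit increases strictly from \<open>k\<close>
  on.\<close>

lemma orbit_le_abs_if_eventually_periodic:
  fixes z :: "nat \<Rightarrow> real"
  assumes z: "\<And>k. z (Suc k) = z k ^ 2 + x" and eq: "z n = z m" "m < n"
  shows "z (Suc k) \<le> \<bar>z k\<bar>"
proof (rule ccontr)
  assume "\<not> z (Suc k) \<le> \<bar>z k\<bar>"
  hence start: "\<bar>z k\<bar> < z (Suc k)" by simp
  have incr: "\<bar>z (j + k)\<bar> < z (Suc (j + k))" for j
  proof (induction j)
    case (Suc j)
    have "z (j + k) ^ 2 < z (Suc (j + k)) ^ 2"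
      using Suc by (intro abs_le_square_iff[THEN iffD1, THEN le_neq_trans] power2_strict_mono) auto
    hence "z (Suc (j + k)) < z (Suc (Suc (j + k)))"
      using z by simp
    thus ?case using Suc by auto
  qed (use start in simp)
  have "strict_mono (\<lambda>j. z (j + k))"
    using incr by (intro strict_mono_Suc_iff[THEN iffD2]) (auto intro: le_less_trans[OF abs_ge_self])
  \<comment> \<open>The coincidence persists along the orbit; for \<open>j = k\<close> it concerns
    two different points of the increasing tail.\<close>
  moreover have "z (n + j) = z (m + j)" for j
    by (induction j) (simp_all add: eq z)
  ultimately show False
    using eq(2) by (metis strict_mono_eq less_irrefl)
qed

text \<open>For w = C - z^2 > 0 the claim reads w * (w - 1) > C. With d = A - u, the last hypothesis
  is d * (d - 1) > A, the case C = A. Raising C by h raises the lower bound d for w by h, and as d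
  \<ge> 1 this raises d * (d - 1) by at least h. So a whole range of C is settled by a check at its
  left end.\<close>

lemma quadratic_escape:
  fixes z C A u :: real
  assumes "A \<le> C" "z ^ 2 \<le> u" "1 \<le> A - u" "0 < (A - u) ^ 2 - 2 * A + u"
  shows "\<bar>z ^ 2 - C\<bar> < (z ^ 2 - C) ^ 2 - C"
proof -
  define w where "w = C - z ^ 2"
  define d where "d = A - u"
  have w: "d + (C - A) \<le> w" using assms(2) by (simp add: w_def d_def)
  have "(d + (C - A)) * (d + (C - A) - 1) \<le> w * (w - 1)"
    using w assms(1,3) by (intro mult_mono) (auto simp: d_def)
  moreover have "d * (d - 1) + (C - A) \<le> (d + (C - A)) * (d + (C - A) - 1)"
  proof -
    have "(d + (C - A)) * (d + (C - A) - 1) - (d * (d - 1) + (C - A)) =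
      (C - A) * (2 * (d - 1) + (C - A))" by (simp add: algebra_simps)
    moreover have "0 \<le> (C - A) * (2 * (d - 1) + (C - A))"
      using assms(1,3) by (intro mult_nonneg_nonneg) (auto simp: d_def)
    ultimately show ?thesis by linarith
  qed
  moreover have "d * (d - 1) > A"
    using assms(4) by (simp add: d_def power2_eq_square algebra_simps)
  ultimately have "w * (w - 1) > C" by linarith
  moreover have "w > 0" using w assms(1,3) by (simp add: d_def)
  moreover have zw: "z ^ 2 - C = - w" by (simp add: w_def)
  ultimately show ?thesis unfolding zw by (simp add: power2_eq_square algebra_simps)
qed

lemma square_le_if_abs_le: "\<bar>z\<bar> \<le> (b::real) \<Longrightarrow> z ^ 2 \<le> b ^ 2"
  by (metis abs_ge_zero power2_abs power_mono)

text \<open>The gap around the parameter \<open>C = (3 + sqrt 5) / 2\<close>, where the orbit of 1 under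
  \<open>z\<^sup>2 - C\<close> meets 0 after two steps.\<close>

lemma escape_if_second_iterate_small:
  fixes C :: real
  defines "z \<equiv> C ^ 2 - 3 * C + 1"
  assumes "237/100 \<le> C" "C \<le> 293/100"
  shows "\<bar>z ^ 2 - C\<bar> < (z ^ 2 - C) ^ 2 - C"
proof -
  \<comment> \<open>As a function of C, z takes its left-end value -4931/10000 exactly at 237/100
    and 63/100. The second product bounds the convex function z by its chord over the
    interval.\<close>
  have "0 \<le> (C - 237/100) * (C - 63/100)" "0 \<le> (C - 237/100) * (293/100 - C)"
    using assms by (intro mult_nonneg_nonneg; simp)+
  hence lo: "-4931/10000 \<le> z" and hi: "z \<le> -4931/10000 + 23/10 * (C - 237/100)"
    by (simp_all add: z_def power2_eq_square field_simps)
  have esc: ?thesis if "A \<le> C" "z \<le> b" "4931/10000 \<le> b"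
      "1 \<le> A - b\<^sup>2" "0 < (A - b\<^sup>2)\<^sup>2 - 2 * A + b\<^sup>2" for A b
    using that lo by (intro quadratic_escape[of A C z "b\<^sup>2"] square_le_if_abs_le) auto
  \<comment> \<open>By the chord bound a larger z forces a larger C, so each piece can use a larger
    \<open>A\<close> to compensate for the larger \<open>b\<close>. At C = 293/100 the chord gives
    7949/10000, just below the final 795/1000.\<close>
  consider "z \<le> 499/1000" | "499/1000 < z" "z \<le> 74/100"
    | "74/100 < z" "z \<le> 79/100" | "79/100 < z"
    by linarith
  thus ?thesis
  proof cases
    case 1 thus ?thesis using assms
      by (intro esc[of "237/100" "499/1000"]) (simp_all add: power2_eq_square)
  next
    case 2 thus ?thesis using hi
      by (intro esc[of "280/100" "74/100"]) (simp_all add: power2_eq_square field_simps)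
  next
    case 3 thus ?thesis using hi
      by (intro esc[of "290/100" "79/100"]) (simp_all add: power2_eq_square field_simps)
  next
    case 4 thus ?thesis using hi assms
      by (intro esc[of "292/100" "795/1000"]) (simp_all add: power2_eq_square field_simps)
  qed
qed

text \<open>The gap around the parameter \<open>C = 2 + 2 * cos (2 * pi / 7)\<close>, where the orbit of 1 meets 0
  after three steps.\<close>

lemma escape_if_third_iterate_small:
  fixes C :: real
  defines "z \<equiv> (C ^ 2 - 3 * C + 1) ^ 2 - C"
  assumes "316/100 \<le> C" "C \<le> 332/100"
  shows "\<bar>z ^ 2 - C\<bar> < (z ^ 2 - C) ^ 2 - C"
proof -
  define y where "y = C ^ 2 - 3 * C + 1"
  define d where "d = C - 316/100"
  have d: "0 \<le> d" "d \<le> 16/100" using assms by (auto simp: d_def)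
  \<comment> \<open>At C = 316/100 the value of y is 15056/10000 and its slope is 332/100. Bounding
    d * d between 0 and 16/100 * d makes the estimates for y, and then for y^2, linear in d.\<close>
  have "0 \<le> d * d" "0 \<le> d * (16/100 - d)"
    using d by (intro mult_nonneg_nonneg; simp)+
  moreover have "y = 15056/10000 + 332/100 * d + d * d"
    by (simp add: y_def d_def power2_eq_square algebra_simps)
  ultimately have y: "15056/10000 + 332/100 * d \<le> y" "y \<le> 15056/10000 + 348/100 * d"
    by (simp_all add: algebra_simps)
  have "y\<^sup>2 \<le> (15056/10000 + 348/100 * d)\<^sup>2" "(15056/10000 + 332/100 * d)\<^sup>2 \<le> y\<^sup>2"
    using y d by (intro power_mono; simp)+
  hence "y\<^sup>2 \<le> 22669/10000 + 1242/100 * d" "22668/10000 + d \<le> y\<^sup>2"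
    using \<open>0 \<le> d * d\<close> \<open>0 \<le> d * (16/100 - d)\<close> d by (simp_all add: power2_eq_square field_simps)
  hence z: "-8932/10000 \<le> z" "z \<le> -8931/10000 + 1142/100 * d"
    unfolding z_def y_def [symmetric] by (simp_all add: d_def field_simps)
  \<comment> \<open>One application over the whole gap fails for z near its maximum; but z > 9/10
    forces C above 3315/1000, and there z stays below 94/100.\<close>
  show ?thesis
  proof (cases "z \<le> 9/10")
    case True
    thus ?thesis using z assms(2,3)
      by (intro quadratic_escape[of "316/100" C z "(9/10)\<^sup>2"] square_le_if_abs_le)
         (simp_all add: power2_eq_square abs_le_iff)
  next
    case False
    thus ?thesis using z d
      by (intro quadratic_escape[of "3315/1000" C z "(94/100)\<^sup>2"] square_le_if_abs_le)
         (simp_all add: power2_eq_square d_def field_simps)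
  qed
qed

lemma quadratic_nonpos_lower_bound:
  assumes "x ^ 2 + 4 * x + 2 \<le> (0::real)"
  shows "-2 - sqrt 2 \<le> x"
proof -
  have "\<bar>x + 2\<bar> \<le> sqrt 2"
    using assms by (intro real_le_rsqrt) (simp add: power2_eq_square algebra_simps)
  thus ?thesis by linarith
qed

text \<open>The bound \<open>z (Suc k) \<le> \<bar>z k\<bar>\<close> is used at four indices: k = 0
  gives x \<le> 0, k = 1 gives x^2 + 4x + 2 \<le> 0 when x < -1, and k = 3 and k = 4 exclude the two
  gaps.\<close>

lemma real_parameter_region:
  fixes z :: "nat \<Rightarrow> real"
  assumes z0: "z 0 = 1" and z: "\<And>k. z (Suc k) = z k ^ 2 + x" and eq: "z n = z m" "m < n"
  shows "-2 - sqrt 2 \<le> x \<and> x \<le> -332/100 \<or> -316/100 \<le> x \<and> x \<le> -293/100 \<or> -237/100 \<le> x \<and> x \<le> 0"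
proof -
  have le: "z k ^ 2 + x \<le> \<bar>z k\<bar>" for k
    using orbit_le_abs_if_eventually_periodic[OF z eq] z by metis
  have z1: "z 1 = 1 + x" using z[of 0] z0 by simp
  have z2: "z 2 = x ^ 2 + 3 * x + 1"
    using z[of 1] z1 by (simp add: numeral_2_eq_2 power2_eq_square algebra_simps)
  have z3: "z 3 = (z 2) ^ 2 + x" using z[of 2] by (simp add: numeral_3_eq_3 numeral_2_eq_2)
  have z4: "z 4 = (z 3) ^ 2 + x" using z[of 3] by (simp add: eval_nat_numeral)
  have "x \<le> 0" using le[of 0] z0 by simp
  moreover have "-2 - sqrt 2 \<le> x"
  proof (cases "x < -1")
    case True
    have "(1 + x) ^ 2 + x \<le> - (1 + x)" using le[of 1] z1 True by simp
    thus ?thesis by (intro quadratic_nonpos_lower_bound) (simp add: power2_eq_square algebra_simps)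
  next
    case False
    have "0 \<le> sqrt (2::real)" by simp
    thus ?thesis using False by linarith
  qed
  moreover have "\<not> (-293/100 \<le> x \<and> x \<le> -237/100)"
    using escape_if_second_iterate_small[of "-x"] le[of 3] z3 by (auto simp: z2)
  moreover have "\<not> (-332/100 \<le> x \<and> x \<le> -316/100)"
    using escape_if_third_iterate_small[of "-x"] le[of 4] z4 z3 by (auto simp: z2)
  ultimately show ?thesis by linarith
qed

section \<open>Minimal polynomials of algebraic integers\<close>

lemma map_poly_of_int_mult:
  "map_poly of_int (p * q) = (map_poly of_int p * map_poly of_int q :: 'a :: comm_ring_1 poly)"
  by (rule poly_eqI) (simp add: coeff_map_poly coeff_mult of_int_sum)

lemma map_poly_of_int_diff:
  "map_poly of_int (p - q) = (map_poly of_int p - map_poly of_int q :: 'a :: ring_1 poly)"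
  by (rule poly_eqI) (simp add: coeff_map_poly)

lemma map_poly_of_int_eq_iff:
  "map_poly of_int p = (map_poly of_int q :: 'a :: ring_char_0 poly) \<longleftrightarrow> p = q"
  by (simp add: poly_eq_iff coeff_map_poly)

lemma map_poly_of_rat_mult:
  "map_poly of_rat (p * q) = (map_poly of_rat p * map_poly of_rat q :: 'a :: field_char_0 poly)"
  by (rule poly_eqI) (simp add: coeff_map_poly coeff_mult of_rat_sum of_rat_mult)

lemma map_poly_of_rat_of_int:
  "map_poly of_rat (map_poly of_int p) = (map_poly of_int p :: 'a :: field_char_0 poly)"
  by (rule poly_eqI) (simp add: coeff_map_poly)

section \<open>Clearing denominators and Gauss's lemma\<close>

lemma rat_poly_common_denominator:
  obtains d :: int and P where "d \<noteq> 0" "smult (of_int d) (p :: rat poly) = map_poly of_int P"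
proof -
  have "\<exists>d P. d \<noteq> (0::int) \<and> smult (of_int d) p = map_poly of_int P"
  proof (induction p)
    case 0
    thus ?case by (intro exI[of _ 1] exI[of _ 0]) simp
  next
    case (pCons a p)
    obtain d P where d: "d \<noteq> 0" "smult (of_int d) p = map_poly of_int P"
      using pCons by blast
    obtain m n where a: "a = of_int m / of_int n" "n > 0"
      by (metis quotient_of_denom_pos quotient_of_div surj_pair)
    have "smult (of_int (n * d)) (pCons a p) = map_poly of_int (pCons (m * d) (smult n P))"
    proof (rule poly_eqI)
      fix i
      have "of_int d * coeff p j = of_int (coeff P j)" for j
        using arg_cong[OF d(2), of "\<lambda>q. coeff q j"] by (simp add: coeff_map_poly)
      thus "coeff (smult (of_int (n * d)) (pCons a p)) i =
          coeff (map_poly of_int (pCons (m * d) (smult n P))) i"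
        using a by (cases i) (simp_all add: coeff_map_poly mult.assoc)
    qed
    thus ?case using d(1) a(2) by (metis less_irrefl mult_eq_0_iff)
  qed
  thus ?thesis using that by blast
qed

lemma monic_rat_poly_primitive_multiple:
  fixes p :: "rat poly"
  assumes "lead_coeff p = 1"
  obtains d :: int and P where "d \<noteq> 0" "content P = 1" "smult (of_int d) p = map_poly of_int P"
proof -
  obtain d P where d: "d \<noteq> 0" "smult (of_int d) p = map_poly of_int P"
    using rat_poly_common_denominator .
  have cf: "of_int d * coeff p i = of_int (coeff P i)" for i
    using arg_cong[OF d(2), of "\<lambda>q. coeff q i"] by (simp add: coeff_map_poly)
  \<comment> \<open>Because \<open>p\<close> is monic, \<open>d\<close> itself is a coefficient of
    \<open>P\<close>. Hence the content divides \<open>d\<close>, and the multiplier left after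
    dividing by it is still an integer.\<close>
  have "coeff P (degree p) = d"
    using cf[of "degree p"] assms by simp
  hence P0: "P \<noteq> 0" using d(1) by auto
  have "content P dvd d"
    using content_dvd_coeff[of P "degree p"] \<open>coeff P (degree p) = d\<close> by simp
  then obtain e where e: "d = content P * e" by (auto elim: dvdE)
  have c0: "content P \<noteq> 0" using P0 by simp
  have "smult (of_int e) p = map_poly of_int (primitive_part P)"
  proof (rule poly_eqI)
    fix i
    have "coeff P i = content P * coeff (primitive_part P) i"
      by (metis coeff_smult content_times_primitive_part)
    hence "of_int (content P) * (of_int e * coeff p i) =
        (of_int (content P) * of_int (coeff (primitive_part P) i) :: rat)"
      using cf[of i] e by (simp add: mult.assoc)
    thus "coeff (smult (of_int e) p) i = coeff (map_poly of_int (primitive_part P)) i"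
      using c0 by (simp add: coeff_map_poly)
  qed
  moreover have "e \<noteq> 0" using e d(1) by auto
  ultimately show ?thesis using that[of e "primitive_part P"] P0 by simp
qed

text \<open>Gauss's lemma: if \<open>P\<close> and \<open>R\<close> are primitive integer multiples
  of \<open>p\<close> and its cofactor, by factors \<open>d\<close> and \<open>e\<close>, then
  \<open>d * e\<close> times \<open>Q\<close> equals \<open>P * R\<close> and is primitive. This
  forces \<open>d\<close> to be a unit.\<close>

lemma monic_dvd_monic_int_poly:
  fixes p :: "rat poly" and Q :: "int poly"
  assumes "lead_coeff p = 1" "lead_coeff Q = 1" "p dvd map_poly of_int Q"
  obtains P where "p = map_poly of_int P"
proof -
  obtain r where r: "map_poly of_int Q = p * r" using assms(3) by (elim dvdE)
  have "lead_coeff (map_poly of_int Q :: rat poly) = 1"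
    using assms(2) by (subst lead_coeff_map_poly_nz) auto
  hence "lead_coeff r = 1" using assms(1) unfolding r lead_coeff_mult by simp
  obtain d P where d: "d \<noteq> 0" "content P = 1" "smult (of_int d) p = map_poly of_int P"
    using monic_rat_poly_primitive_multiple[OF assms(1)] .
  obtain e R where e: "e \<noteq> 0" "content R = 1" "smult (of_int e) r = map_poly of_int R"
    using monic_rat_poly_primitive_multiple[OF \<open>lead_coeff r = 1\<close>] .
  have "map_poly of_int (smult (d * e) Q) = smult (of_int d) p * smult (of_int e) r"
    by (simp add: map_poly_smult r mult.commute)
  hence "smult (d * e) Q = P * R"
    unfolding d(3) e(3) map_poly_of_int_mult [symmetric] map_poly_of_int_eq_iff .
  hence "lead_coeff (smult (d * e) Q) = lead_coeff (P * R)" "content (smult (d * e) Q) = 1"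
    using d(2) e(2) by (simp_all add: content_mult)
  hence "\<bar>d * e\<bar> * content Q = 1" by (simp add: content_smult)
  hence "\<bar>d * e\<bar> = 1" using zmult_eq_1_iff by (metis abs_ge_zero zdvd1_eq dvd_triv_left abs_abs)
  hence "\<bar>d\<bar> = 1" by (metis abs_abs dvd_triv_left zdvd1_eq abs_mult)
  hence "d * d = 1" by (metis abs_mult_self_eq mult_1)
  have "p = smult (of_int d) (smult (of_int d) p)"
    using \<open>d * d = 1\<close> by (simp flip: of_int_mult)
  also have "\<dots> = map_poly of_int (smult d P)"
    unfolding d(3) by (simp add: map_poly_smult)
  finally show ?thesis using that by blast
qed

section \<open>Divisibility by the minimal polynomial and conjugate roots\<close>

lemma is_rat_min_poly_rat_min_poly:
  assumes "algebraic c"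
  shows "is_rat_min_poly c (rat_min_poly c)"
  using theI'[OF ex1_rat_min_poly[OF assms]] by (simp add: rat_min_poly_def)

lemma rat_min_poly_dvd:
  assumes "algebraic c" "poly (map_poly of_rat q) c = 0"
  shows "rat_min_poly c dvd q"
proof -
  define p where "p = rat_min_poly c"
  have p: "lead_coeff p = 1" "poly (map_poly of_rat p) c = 0"
    "\<And>q. q \<noteq> 0 \<Longrightarrow> poly (map_poly of_rat q) c = 0 \<Longrightarrow> degree p \<le> degree q"
    using is_rat_min_poly_rat_min_poly[OF assms(1)] by (auto simp: p_def is_rat_min_poly_def)
  have "poly (map_poly of_rat (q div p * p + q mod p)) c = 0"
    using assms(2) by simp
  hence "poly (map_poly of_rat (q mod p)) c = 0"
    unfolding poly_of_rat_add map_poly_of_rat_mult using p(2) by simp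
  moreover have "p \<noteq> 0" using p(1) by auto
  ultimately have "q mod p = 0"
    using p(3) degree_mod_less[of p q] by fastforce
  thus ?thesis by (simp add: p_def mod_eq_0_iff_dvd)
qed

lemma algebraic_if_rat_poly_root:
  assumes "q \<noteq> 0" "poly (map_poly of_rat q) (c :: complex) = 0"
  shows "algebraic c"
  unfolding algebraic_altdef
  using assms by (intro exI[of _ "map_poly of_rat q"]) (auto simp: coeff_map_poly map_poly_eq_0_iff)

text \<open>This expresses irreducibility through roots. The minimal polynomial \<open>d\<close> of
  \<open>z\<close> divides both \<open>p\<close> and \<open>q\<close>; the cofactor of
  \<open>d\<close> in \<open>p\<close> has smaller degree than \<open>p\<close>, so it cannot vanish
  at \<open>c\<close>, and \<open>d\<close> must.\<close>

lemma rat_min_poly_common_root: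
  fixes c z :: complex
  assumes "algebraic c" "poly (map_poly of_rat (rat_min_poly c)) z = 0"
    and "poly (map_poly of_rat q) z = 0"
  shows "poly (map_poly of_rat q) c = 0"
proof -
  define p where "p = rat_min_poly c"
  have p: "lead_coeff p = 1" "poly (map_poly of_rat p) c = 0"
    "\<And>q. q \<noteq> 0 \<Longrightarrow> poly (map_poly of_rat q) c = 0 \<Longrightarrow> degree p \<le> degree q"
    using is_rat_min_poly_rat_min_poly[OF assms(1)] by (auto simp: p_def is_rat_min_poly_def)
  have z: "algebraic z"
    using assms(2) p(1) by (intro algebraic_if_rat_poly_root[of p]) (auto simp: p_def)
  define d where "d = rat_min_poly z"
  have dz: "poly (map_poly of_rat d) z = 0"
    using is_rat_min_poly_rat_min_poly[OF z] by (simp add: d_def is_rat_min_poly_def)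
  obtain s where s: "p = d * s"
    using rat_min_poly_dvd[OF z assms(2)] by (auto simp: p_def d_def)
  obtain t where t: "q = d * t"
    using rat_min_poly_dvd[OF z assms(3)] by (auto simp: d_def)
  have s0: "s \<noteq> 0" and d0: "d \<noteq> 0" using p(1) s by auto
  have "degree d \<noteq> 0"
  proof
    assume "degree d = 0"
    then obtain a where "d = [:a:]" by (auto elim: degree_eq_zeroE)
    thus False using dz d0 by (simp add: map_poly_pCons)
  qed
  hence "degree s < degree p" using s0 d0 unfolding s by (simp add: degree_mult_eq)
  hence "poly (map_poly of_rat s) c \<noteq> 0" using p(3)[OF s0] by auto
  hence "poly (map_poly of_rat d) c = 0"
    using p(2) unfolding s map_poly_of_rat_mult by simp
  thus ?thesis unfolding t map_poly_of_rat_mult by simp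
qed

section \<open>Orbit polynomials and the product over the conjugates\<close>

lemma map_poly_of_int_add:
  "map_poly of_int (p + q) = (map_poly of_int p + map_poly of_int q :: 'a :: ring_1 poly)"
  by (rule poly_eqI) (simp add: coeff_map_poly)

text \<open>The orbit of 1 as polynomials in the parameter: \<open>[:0, 1:]\<close> stands for c, so
  evaluating at c yields the iterates.\<close>

primrec orbit_poly :: "nat \<Rightarrow> int poly" where
  "orbit_poly 0 = 1"
| "orbit_poly (Suc n) = orbit_poly n ^ 2 + [:0, 1:]"

lemma poly_orbit_poly: "poly (map_poly of_int (orbit_poly n)) c = (quad c ^^ n) 1"
  by (induction n)
     (simp_all add: quad_def map_poly_of_int_add map_poly_of_int_mult power2_eq_square map_poly_pCons)

text \<open>The doubling starts at index 1, where the polynomial is 1 + c. Squaring doubles the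
  degree, and the added c has lower degree than the square, so the polynomial stays monic.\<close>

lemma degree_orbit_poly_Suc:
  "degree (orbit_poly (Suc n)) = 2 ^ n \<and> lead_coeff (orbit_poly (Suc n)) = 1"
proof (induction n)
  case (Suc n)
  define q where "q = orbit_poly (Suc n)"
  have q: "degree q = 2 ^ n" "lead_coeff q = 1" using Suc unfolding q_def by blast+
  have "q \<noteq> 0" using q(2) by auto
  have sq: "degree (q ^ 2) = 2 ^ Suc n" "lead_coeff (q ^ 2) = 1"
    using q(1) \<open>q \<noteq> 0\<close> by (simp add: degree_power_eq) (metis lead_coeff_power power_one q(2))
  have "degree [:0, 1 :: int:] < degree (q ^ 2)"
    using sq(1) one_less_power[of "2::nat" "Suc n"] by simp
  hence "degree (q ^ 2 + [:0, 1:]) = 2 ^ Suc n" "lead_coeff (q ^ 2 + [:0, 1:]) = 1"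
    using sq by (simp_all add: degree_add_eq_left lead_coeff_add_le coeff_eq_0 del: power_Suc)
  moreover have "orbit_poly (Suc (Suc n)) = q ^ 2 + [:0, 1:]" by (simp add: q_def)
  ultimately show ?case by metis
next
  case 0
  have "orbit_poly (Suc 0) = 1 + [:0, 1:]" by simp
  also have "\<dots> = [:1, 1:]" by (simp add: one_pCons)
  finally show ?case by simp
qed

lemma lead_coeff_orbit_poly_diff:
  assumes "0 < m" "m < n"
  shows "lead_coeff (orbit_poly n - orbit_poly m) = 1"
proof -
  obtain m' n' where mn: "m = Suc m'" "n = Suc n'" using assms by (cases m; cases n) auto
  have "degree (orbit_poly m) < degree (orbit_poly n)"
    using assms unfolding mn using degree_orbit_poly_Suc[of m'] degree_orbit_poly_Suc[of n'] by simp
  hence "degree (orbit_poly n - orbit_poly m) = degree (orbit_poly n)"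
      "coeff (orbit_poly m) (degree (orbit_poly n)) = 0"
    using degree_add_eq_left[of "- orbit_poly m" "orbit_poly n"] by (simp_all add: coeff_eq_0)
  moreover have "degree (orbit_poly n) = 2 ^ n'" "lead_coeff (orbit_poly n) = 1"
    using degree_orbit_poly_Suc[of n'] unfolding mn(2) by blast+
  ultimately show ?thesis by simp
qed

text \<open>The points 1 and -1 have the same image, so their orbits agree after one step. Shifting
  both indices by one transfers the coincidence to 1 and makes \<open>m\<close> positive.\<close>

lemma preperiodic_pm1E:
  assumes "\<alpha> \<in> {1, -1}" "preperiodic (quad c) \<alpha>"
  obtains m n where "0 < m" "m < n" "(quad c ^^ n) 1 = (quad c ^^ m) 1"
proof -
  obtain m n where mn: "m < n" "(quad c ^^ n) \<alpha> = (quad c ^^ m) \<alpha>"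
    using assms(2) by (auto simp: preperiodic_def)
  have "(quad c ^^ Suc k) \<alpha> = (quad c ^^ Suc k) 1" for k
    using assms(1) by (auto simp: funpow_Suc_right quad_def simp del: funpow.simps)
  moreover have "(quad c ^^ Suc n) \<alpha> = (quad c ^^ Suc m) \<alpha>" using mn(2) by simp
  ultimately have "(quad c ^^ Suc n) 1 = (quad c ^^ Suc m) 1" by metis
  thus ?thesis using that[of "Suc m" "Suc n"] mn(1) by blast
qed

lemma aux_weight_less_1_if_eventually_periodic:
  assumes "m < n" "(quad (of_real x) ^^ n) 1 = (quad (of_real x) ^^ m) 1"
  shows "aux_weight x < 1"
proof -
  define z where "z k = ((\<lambda>y. y ^ 2 + x) ^^ k) 1" for k
  have "of_real (z k) = (quad (of_real x) ^^ k) 1" for k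
    by (induction k) (simp_all add: z_def quad_def)
  hence "z n = z m" using assms(2) by (metis of_real_eq_iff)
  thus ?thesis
    using assms(1) by (intro aux_weight_less_1 real_parameter_region[of z x n m]) (simp_all add: z_def)
qed

section \<open>Integrality of the product over the conjugates\<close>

lemma poly_of_int_of_int: "poly (map_poly of_int P) (of_int k) = (of_int (poly P k) :: 'a :: comm_ring_1)"
  by (induction P) (simp_all add: map_poly_pCons)

text \<open>The two values have the conjugate forms A + B s and A - B s with integers A and B, so
  their product is the norm A^2 - d B^2.\<close>

lemma poly_conjugate_product_int:
  fixes P :: "int poly" and s :: "'a :: comm_ring_1"
  assumes "s ^ 2 = of_int d"
  shows "\<exists>k. poly (map_poly of_int P) (of_int a + s) * poly (map_poly of_int P) (of_int a - s) = of_int k"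
proof -
  have "\<exists>A B. poly (map_poly of_int P) (of_int a + s) = of_int A + of_int B * s \<and>
      poly (map_poly of_int P) (of_int a - s) = of_int A - of_int B * s"
  proof (induction P)
    case (pCons b P)
    then obtain A B where AB: "poly (map_poly of_int P) (of_int a + s) = of_int A + of_int B * s"
      "poly (map_poly of_int P) (of_int a - s) = of_int A - of_int B * s" by blast
    have "s * (s * of_int B) = of_int (d * B)"
      using assms by (simp add: power2_eq_square flip: mult.assoc)
    \<comment> \<open>The witnesses come from expanding b + (a + s) (A + B s) with s^2 = d.\<close>
    thus ?case
      by (rule_tac exI[of _ "b + a * A + d * B"], rule_tac exI[of _ "A + a * B"])
         (simp add: map_poly_pCons AB, simp add: algebra_simps)
  qed (auto intro!: exI[of _ 0])
  then obtain A B where AB: "poly (map_poly of_int P) (of_int a + s) = of_int A + of_int B * s"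
      "poly (map_poly of_int P) (of_int a - s) = of_int A - of_int B * s" by blast
  have "(of_int A + of_int B * s) * (of_int A - of_int B * s) = of_int A ^ 2 - of_int B ^ 2 * s ^ 2"
    by (simp add: power2_eq_square algebra_simps)
  also have "\<dots> = of_int (A ^ 2 - B ^ 2 * d)" by (simp add: assms)
  finally show ?thesis unfolding AB by blast
qed

lemma aux_weight_nonneg: "0 \<le> aux_weight x"
  by (simp add: aux_weight_def)

lemma small_conjugates_root:
  fixes P :: "int poly"
  defines "p \<equiv> map_poly of_int P :: complex poly" and "s \<equiv> complex_of_real (sqrt 2)"
  assumes monic: "lead_coeff P = 1" and deg: "degree P > 0"
    and roots: "\<And>z. poly p z = 0 \<Longrightarrow> z \<in> \<real> \<and> aux_weight (Re z) < 1"
  shows "\<exists>x \<in> {0, -1, -2, -3, -2 + s, -2 - s}. poly p x = 0"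
proof -
  have degp: "degree p = degree P" "lead_coeff p = 1"
    using monic by (simp_all add: p_def degree_map_poly coeff_map_poly)
  obtain r where "smult (lead_coeff p) (\<Prod>i<degree p. [:- r i, 1:]) = p"
    using complex_poly_decompose' .
  hence p: "p = (\<Prod>i<degree P. [:- r i, 1:])" using degp by simp
  define t where "t i = Re (r i)" for i
  have r: "r i = of_real (t i)" "aux_weight (t i) < 1" if "i < degree P" for i
  proof -
    have "poly p (r i) = 0" using that unfolding p poly_prod by (intro prod_zero) auto
    from roots[OF this] show "r i = of_real (t i)" "aux_weight (t i) < 1"
      by (auto simp: t_def complex_is_Real_iff complex_eq_iff)
  qed
  have val: "norm (poly p (of_real x)) = (\<Prod>i<degree P. \<bar>t i - x\<bar>)" for x
  proof -
    have "norm (poly p (of_real x)) = (\<Prod>i<degree P. norm (of_real x - r i))"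
      unfolding p poly_prod by (simp add: prod_norm)
    also have "\<dots> = (\<Prod>i<degree P. \<bar>t i - x\<bar>)"
      using r(1) by (intro prod.cong) (auto simp: abs_minus_commute simp flip: of_real_diff)
    finally show ?thesis .
  qed
  define N where "N x = norm (poly p x)" for x
  have "(\<Prod>i<degree P. aux_weight (t i)) =
      N 0 ^ 13 * N (-1) ^ 7 * N (-2) ^ 16 * N (-3) ^ 10 *
        (N (-2 + s) * N (-2 - s)) ^ 11"
    using val[of 0] val[of "-1"] val[of "-2"] val[of "-3"] val[of "-2 + sqrt 2"] val[of "-2 - sqrt 2"]
    by (simp add: N_def s_def aux_weight_def prod.distrib prod_power_distrib diff_diff_eq2 algebra_simps)
  \<comment> \<open>By \<open>deg\<close> there is at least one conjugate, so the inequality between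
    the products is strict.\<close>
  moreover have "(\<Prod>i<degree P. aux_weight (t i)) < (\<Prod>i<degree P. 1)"
    using deg r(2) by (intro prod_mono_strict) (auto simp: aux_weight_nonneg lessThan_empty_iff intro: less_imp_le)
  ultimately have less: "N 0 ^ 13 * N (-1) ^ 7 * N (-2) ^ 16 * N (-3) ^ 10 *
        (N (-2 + s) * N (-2 - s)) ^ 11 < 1"
    by simp
  have int: "N (of_int k) = of_int \<bar>poly P k\<bar>" for k
    by (simp add: N_def p_def poly_of_int_of_int)
  \<comment> \<open>The values at the two irrational zeros are combined into a single integer, which
    is possible because both carry the exponent 11 in \<open>aux_weight\<close>.\<close>
  have "s ^ 2 = of_int 2" by (simp add: s_def flip: of_real_power)
  then obtain k where "poly p (of_int (-2) + s) * poly p (of_int (-2) - s) = of_int k"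
    using poly_conjugate_product_int[of s 2 P "-2"] unfolding p_def by blast
  hence "N (-2 + s) * N (-2 - s) = of_int \<bar>k\<bar>"
    unfolding N_def norm_mult [symmetric] by simp
  moreover define K where
    "K = \<bar>poly P 0\<bar> ^ 13 * \<bar>poly P (-1)\<bar> ^ 7 * \<bar>poly P (-2)\<bar> ^ 16 *
        \<bar>poly P (-3)\<bar> ^ 10 * \<bar>k\<bar> ^ 11"
  ultimately have K: "of_int K = N 0 ^ 13 * N (-1) ^ 7 * N (-2) ^ 16 * N (-3) ^ 10 *
        (N (-2 + s) * N (-2 - s)) ^ 11"
    using int[of 0] int[of "-1"] int[of "-2"] int[of "-3"] by simp
  with less have "K < 1" by (metis of_int_less_1_iff)
  moreover have "0 \<le> K" by (simp add: K_def)
  ultimately have "K = 0" by simp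
  with K have "N 0 ^ 13 * N (-1) ^ 7 * N (-2) ^ 16 * N (-3) ^ 10 *
        (N (-2 + s) * N (-2 - s)) ^ 11 = 0"
    by (metis of_int_0)
  thus ?thesis by (auto simp: N_def)
qed

section \<open>The six parameters are totally real and make 1 and -1 preperiodic\<close>

lemma quadratic_roots:
  "z ^ 2 + 4 * z + 2 = 0 \<longleftrightarrow> z = -2 + of_real (sqrt 2) \<or> z = -2 - complex_of_real (sqrt 2)"
proof -
  have "complex_of_real (sqrt 2) ^ 2 = 2" by (simp flip: of_real_power)
  hence "z ^ 2 + 4 * z + 2 = (z - (-2 + of_real (sqrt 2))) * (z - (-2 - complex_of_real (sqrt 2)))"
    by (simp add: power2_eq_square algebra_simps)
  thus ?thesis by simp
qed

text \<open>The minimal polynomial divides \<open>q\<close>, so its roots are among those of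
  \<open>q\<close>; it need not be computed.\<close>

lemma totally_realI:
  fixes c :: complex
  assumes "q \<noteq> 0" "poly (map_poly of_rat q) c = 0"
    and "\<And>z :: complex. poly (map_poly of_rat q) z = 0 \<Longrightarrow> z \<in> \<real>"
  shows "totally_real c"
proof -
  have "algebraic c" using assms(1,2) by (rule algebraic_if_rat_poly_root)
  moreover obtain t where "q = rat_min_poly c * t"
    using rat_min_poly_dvd[OF \<open>algebraic c\<close> assms(2)] by (elim dvdE)
  ultimately show ?thesis
    using assms(3) by (simp add: totally_real_def map_poly_of_rat_mult)
qed

lemma totally_real_of_int: "totally_real (of_int a)"
  by (rule totally_realI[of "[:- of_int a, 1:]"]) (auto simp: map_poly_pCons of_rat_minus)

lemma totally_real_quadratic:
  "totally_real (-2 + of_real (sqrt 2))" "totally_real (-2 - of_real (sqrt 2))"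
proof -
  have "poly (map_poly of_rat [:2, 4, 1:]) z = z ^ 2 + 4 * z + 2" for z :: complex
    by (simp add: map_poly_pCons power2_eq_square algebra_simps)
  hence *: "poly (map_poly of_rat [:2, 4, 1:]) z = 0 \<longleftrightarrow>
     z = -2 + of_real (sqrt 2) \<or> z = -2 - complex_of_real (sqrt 2)" for z :: complex
    by (simp only: quadratic_roots)
  show "totally_real (-2 + of_real (sqrt 2))" "totally_real (-2 - of_real (sqrt 2))"
    by (rule totally_realI[of "[:2, 4, 1:]"]; use * in auto)+
qed

text \<open>After one step the orbit is at 1 + c. This is fixed for c = 0 and c = -2, and has period
  2 for c = -1 and c = -3. For the quadratic parameters the next point is -(1 + c), which is
  fixed.\<close>

lemma preperiodic_quad_pm1:
  assumes "\<alpha> \<in> {1, -1}" "c \<in> {0, -1, -2, -3} \<or> c ^ 2 + 4 * c + 2 = 0"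
  shows "preperiodic (quad c) \<alpha>"
proof -
  have f: "quad c \<alpha> = 1 + c" using assms(1) by (auto simp: quad_def)
  have "quad c (1 + c) = 1 + c \<or> quad c (quad c (1 + c)) = 1 + c \<or>
      quad c (quad c (1 + c)) = quad c (1 + c)"
    using assms(2)
  proof
    assume "c ^ 2 + 4 * c + 2 = 0"
    moreover have "quad c (1 + c) - (- (1 + c)) = c ^ 2 + 4 * c + 2"
      by (simp add: quad_def power2_eq_square algebra_simps)
    ultimately have "quad c (1 + c) = - (1 + c)" by simp
    moreover have "quad c (- (1 + c)) = quad c (1 + c)" unfolding quad_def power2_minus ..
    ultimately show ?thesis by simp
  qed (auto simp: quad_def)
  hence "(quad c ^^ 2) \<alpha> = (quad c ^^ 1) \<alpha> \<or> (quad c ^^ 3) \<alpha> = (quad c ^^ 1) \<alpha> \<or>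
      (quad c ^^ 3) \<alpha> = (quad c ^^ 2) \<alpha>"
    by (simp add: eval_nat_numeral f)
  moreover have "(1::nat) < 2" "(1::nat) < 3" "(2::nat) < 3" by simp_all
  ultimately show ?thesis unfolding preperiodic_def by metis
qed

theorem theorem1p5:
  fixes \<alpha> :: complex
  assumes "\<alpha> \<in> {1, -1}"
  shows "{c. totally_real c \<and> preperiodic (quad c) \<alpha>} =
           {-2 - of_real (sqrt 2), -3, -2, -1, -2 + of_real (sqrt 2), 0}"
proof (intro equalityI subsetI)
  fix c assume "c \<in> {c. totally_real c \<and> preperiodic (quad c) \<alpha>}"
  hence alg: "algebraic c"
    and real: "\<And>z::complex. poly (map_poly of_rat (rat_min_poly c)) z = 0 \<Longrightarrow> z \<in> \<real>"
    and prep: "preperiodic (quad c) \<alpha>" by (auto simp: totally_real_def)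
  obtain m n where mn: "0 < m" "m < n" "(quad c ^^ n) 1 = (quad c ^^ m) 1"
    using preperiodic_pm1E[OF assms prep] .
  define p where "p = rat_min_poly c"
  define Q where "Q = orbit_poly n - orbit_poly m"
  have Q: "poly (map_poly of_int Q) z = 0 \<longleftrightarrow> (quad z ^^ n) 1 = (quad z ^^ m) 1" for z
    by (simp add: Q_def map_poly_of_int_diff poly_orbit_poly)
  have p: "lead_coeff p = 1" "poly (map_poly of_rat p) c = 0"
    using is_rat_min_poly_rat_min_poly[OF alg] by (auto simp: p_def is_rat_min_poly_def)
  have dvd: "p dvd map_poly of_int Q"
    unfolding p_def by (rule rat_min_poly_dvd[OF alg]) (simp add: map_poly_of_rat_of_int Q mn(3))
  obtain P where P: "p = map_poly of_int P"
    using monic_dvd_monic_int_poly[OF p(1) _ dvd] lead_coeff_orbit_poly_diff[OF mn(1,2)]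
    unfolding Q_def by blast
  have pP: "map_poly of_rat p = (map_poly of_int P :: complex poly)"
    unfolding P by (rule map_poly_of_rat_of_int)
  have monic: "lead_coeff P = 1"
    using p(1) unfolding P by (simp add: degree_map_poly coeff_map_poly)
  have deg: "degree P > 0"
  proof (rule ccontr)
    assume "\<not> degree P > 0"
    hence "P = 1" using monic by (auto elim: degree_eq_zeroE)
    thus False using p(2) unfolding pP by simp
  qed
  have roots: "z \<in> \<real> \<and> aux_weight (Re z) < 1" if "poly (map_poly of_int P) z = 0" for z :: complex
  proof -
    have z: "poly (map_poly of_rat p) z = 0" using that pP by simp
    hence "z \<in> \<real>" using real by (simp add: p_def)
    then obtain x where x: "z = of_real x" by (auto elim: Reals_cases)
    \<comment> \<open>Since \<open>p\<close> divides \<open>Q\<close>, the orbit coincidence passes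
      from \<open>c\<close> to each of its conjugates \<open>z\<close>.\<close>
    obtain t where "map_poly of_int Q = p * t" using dvd by (elim dvdE)
    hence "poly (map_poly of_rat (map_poly of_int Q)) z = 0"
      using z by (simp add: map_poly_of_rat_mult)
    hence "(quad z ^^ n) 1 = (quad z ^^ m) 1"
      by (simp add: map_poly_of_rat_of_int Q)
    thus ?thesis
      using aux_weight_less_1_if_eventually_periodic[OF mn(2), of x] \<open>z \<in> \<real>\<close> x by simp
  qed
  obtain x where x: "x \<in> {0, -1, -2, -3, -2 + of_real (sqrt 2), -2 - complex_of_real (sqrt 2)}"
    "poly (map_poly of_rat p) x = 0"
    using small_conjugates_root[OF monic deg roots] unfolding pP by blast
  \<comment> \<open>So far \<open>x\<close> is only a conjugate of \<open>c\<close>. Testing with X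
    - a identifies \<open>c\<close> with a rational \<open>x\<close>; for an irrational
    \<open>x\<close>, testing with X^2 + 4X + 2 leaves two possible values for \<open>c\<close>,
    both in the list.\<close>
  have conj: "poly (map_poly of_rat q) x = 0 \<Longrightarrow> poly (map_poly of_rat q) c = 0" for q
    using rat_min_poly_common_root[OF alg] x(2) unfolding p_def by blast
  have "x = c" if "x = of_rat a" for a
    using conj[of "[:- a, 1:]"] that by (simp add: map_poly_pCons of_rat_minus)
  from this[of 0] this[of "-1"] this[of "-2"] this[of "-3"]
  have "x \<in> {0, -1, -2, -3} \<Longrightarrow> x = c" by (auto simp: of_rat_minus)
  moreover have "c \<in> {-2 + of_real (sqrt 2), -2 - complex_of_real (sqrt 2)}"
    if "x \<in> {-2 + of_real (sqrt 2), -2 - complex_of_real (sqrt 2)}"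
  proof -
    have q: "poly (map_poly of_rat [:2, 4, 1:]) z = z ^ 2 + 4 * z + 2" for z :: complex
      by (simp add: map_poly_pCons power2_eq_square algebra_simps)
    show ?thesis
      using conj[of "[:2, 4, 1:]"] that unfolding q quadratic_roots by auto
  qed
  ultimately show "c \<in> {-2 - of_real (sqrt 2), -3, -2, -1, -2 + of_real (sqrt 2), 0}"
    using x(1) by auto
next
  fix c :: complex assume c: "c \<in> {-2 - of_real (sqrt 2), -3, -2, -1, -2 + of_real (sqrt 2), 0}"
  hence "totally_real c"
    using totally_real_quadratic totally_real_of_int[of 0] totally_real_of_int[of "-1"]
      totally_real_of_int[of "-2"] totally_real_of_int[of "-3"] by auto
  moreover have "preperiodic (quad c) \<alpha>"
    using c quadratic_roots[of c] by (intro preperiodic_quad_pm1 assms) auto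
  ultimately show "c \<in> {c. totally_real c \<and> preperiodic (quad c) \<alpha>}" by simp
qed

end
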